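(* Let $G$ be a finite weighted graph with vertex set $V$ and graph Laplacian $\mathcal{L}$. For every set of vertices $U\subset V$ for which $S=V\setminus U$ is a $\Lambda$-set, and for any $\varepsilon>0$ and $k=2^l$, $l\in\mathbb{N}$, there exist weights $\theta_u=\theta_u(U,k,\varepsilon)$, $u\in U$ (namely $\theta_u=\sum_{v\in V}L^{U,u}_{k,\varepsilon}(v)$), such that for every function $f\in L_2(G)$, $$\left|\sum_{v\in V}f(v)-\sum_{u\in U}f(u)\theta_u\right|\le 2\sqrt{|S|}\,\Lambda^k\left\|(\varepsilon I+\mathcal{L})^kf\right\| .$$
   Context: $G$ is an undirected weighted graph with finite vertex set $V=V(G)$ and symmetric weight function $w:V\times V\to[0,\infty)$, $w(u,v)=w(v,u)$, $w(u,u)=0$; pairs with $w(u,v)\neq0$ are edges. $L_2(G)$ is the space of real-valued functions on $V$ with inner product $\langle f,g\rangle=\sum_{v\in V}f(v)g(v)$ and norm $\|f\|=\left(\sum_{v\in V}|f(v)|^2\right)^{1/2}$. The Laplacian is $(\mathcal{L}f)(v)=\sum_{u\in V}(f(v)-f(u))w(v,u)$, a positive-semidefinite self-adjoint operator on $L_2(G)$. For $S\subset V$, $L_2(S)=\{\varphi\in L_2(G):\varphi(v)=0 \text{ for } v\in V\setminus S\}$. The set $S$ is a $\Lambda$-set, where $\Lambda>0$ is a constant, if $\|\varphi\|\le\Lambda\|\mathcal{L}\varphi\|$ for all $\varphi\in L_2(S)$. Variational splines: given $U\subset V$, $k\in\mathbb{N}$, $\varepsilon>0$ and real numbers $y=\{y_u\}_{u\in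 U}$, the variational spline $Y^{U,y}_{k,\varepsilon}$ is the unique function $Y\in L_2(G)$ with $Y(u)=y_u$ for all $u\in U$ which minimizes $\|(\varepsilon I+\mathcal{L})^kY\|$ among all functions satisfying these constraints. For $u\in U$, the Lagrangian spline $L^{U,u}_{k,\varepsilon}$ is the variational spline with the constraints $L^{U,u}_{k,\varepsilon}(v)=\delta_{u,v}$ (Kronecker delta) for $v\in U$. *)

theory Defs
  imports "HOL-Analysis.Analysis"
begin

text \<open>
  The vertex set is the universe of a finite type \<open>'v\<close>. The space $L_2(G)$ is
  \<open>real ^ 'v\<close>, whose \<^const>\<open>norm\<close> is the Euclidean one; \<open>f $ v\<close> is the value
  of \<open>f\<close> at the vertex \<open>v\<close>.
\<close>

definition weighted_graph :: "('v::finite \<Rightarrow> 'v \<Rightarrow> real) \<Rightarrow> bool" where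
  "weighted_graph w \<longleftrightarrow>
     (\<forall>u v. 0 \<le> w u v) \<and> (\<forall>u v. w u v = w v u) \<and> (\<forall>u. w u u = 0)"

definition laplacian :: "('v::finite \<Rightarrow> 'v \<Rightarrow> real) \<Rightarrow> real ^ 'v \<Rightarrow> real ^ 'v" where
  "laplacian w f = (\<chi> v. \<Sum>u\<in>UNIV. (f $ v - f $ u) * w v u)"

definition L2_on :: "'v::finite set \<Rightarrow> (real ^ 'v) set" where
  "L2_on S = {\<phi>. \<forall>v. v \<notin> S \<longrightarrow> \<phi> $ v = 0}"

definition Lambda_set :: "('v::finite \<Rightarrow> 'v \<Rightarrow> real) \<Rightarrow> real \<Rightarrow> 'v set \<Rightarrow> bool" where
  "Lambda_set w \<Lambda> S \<longleftrightarrow>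
     \<Lambda> > 0 \<and> (\<forall>\<phi>\<in>L2_on S. norm \<phi> \<le> \<Lambda> * norm (laplacian w \<phi>))"

text \<open>The operator $(\varepsilon I + \mathcal{L})^k$.\<close>

definition shifted_laplacian_power ::
    "('v::finite \<Rightarrow> 'v \<Rightarrow> real) \<Rightarrow> real \<Rightarrow> nat \<Rightarrow> real ^ 'v \<Rightarrow> real ^ 'v" where
  "shifted_laplacian_power w \<epsilon> k = ((\<lambda>f. \<epsilon> *\<^sub>R f + laplacian w f) ^^ k)"

text \<open>Only the values of \<open>y\<close> on \<open>U\<close> matter.\<close>

definition is_variational_spline ::
    "('v::finite \<Rightarrow> 'v \<Rightarrow> real) \<Rightarrow> 'v set \<Rightarrow> nat \<Rightarrow> real \<Rightarrow> ('v \<Rightarrow> real) \<Rightarrow> real ^ 'v \<Rightarrow> bool" where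
  "is_variational_spline w U k \<epsilon> y Y \<longleftrightarrow>
     (\<forall>u\<in>U. Y $ u = y u) \<and>
     (\<forall>Z. (\<forall>u\<in>U. Z $ u = y u) \<longrightarrow>
        norm (shifted_laplacian_power w \<epsilon> k Y) \<le> norm (shifted_laplacian_power w \<epsilon> k Z))"

definition variational_spline ::
    "('v::finite \<Rightarrow> 'v \<Rightarrow> real) \<Rightarrow> 'v set \<Rightarrow> nat \<Rightarrow> real \<Rightarrow> ('v \<Rightarrow> real) \<Rightarrow> real ^ 'v" where
  "variational_spline w U k \<epsilon> y = (THE Y. is_variational_spline w U k \<epsilon> y Y)"

definition lagrangian_spline ::
    "('v::finite \<Rightarrow> 'v \<Rightarrow> real) \<Rightarrow> 'v set \<Rightarrow> nat \<Rightarrow> real \<Rightarrow> 'v \<Rightarrow> real ^ 'v" where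
  "lagrangian_spline w U k \<epsilon> u =
     variational_spline w U k \<epsilon> (\<lambda>v. if v = u then 1 else 0)"

end

theory Submission
  imports Defs
begin

text \<open>
  Write \<open>T = \<epsilon> I + L\<close> and \<open>A = T\<^sup>k\<close>. A function interpolating given values on \<open>U\<close> is
  determined up to an element of the space \<open>L2_on S\<close> of functions vanishing on \<open>U\<close>, so
  minimising \<open>norm (A Y)\<close> is a least squares problem: as \<open>A\<close> is injective, the minimiser exists,
  is unique, and is characterised by \<open>A Y\<close> being orthogonal to the image of \<open>L2_on S\<close> under \<open>A\<close>
  (\<open>variational_spline_orthogonal\<close>).

  Orthogonality is linear in the data. Hence for the interpolant \<open>\<Sum>u\<in>U. f u L\<^sup>u\<close> of \<open>f\<close>, with
  interpolation error \<open>\<phi>\<close>, the vector \<open>A f\<close> is the orthogonal sum of the image of the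
  interpolant and \<open>A \<phi>\<close>, so that \<open>norm (A \<phi>) \<le> norm (A f)\<close>. The quadrature error is the sum of
  \<open>\<phi>\<close> over \<open>S\<close>, at most \<open>sqrt (card S) * norm \<phi>\<close> by Cauchy--Schwarz. It remains to bound
  \<open>norm \<phi>\<close> by \<open>\<Lambda>\<^sup>k * norm (A \<phi>)\<close> for \<open>\<phi>\<close> in \<open>L2_on S\<close>. For \<open>k = 1\<close> this is the property of a
  \<open>\<Lambda>\<close>-set together with \<open>norm (L \<phi>) \<le> norm (T \<phi>)\<close>, which holds because \<open>L\<close> is positive
  semidefinite. The space \<open>L2_on S\<close> is in general not invariant under \<open>T\<close>, so the inequality cannot
  simply be applied again to \<open>T \<phi>\<close>; instead, self-adjointness allows the exponent to be doubled
  for each single vector \<open>\<phi>\<close> (\<open>self_adjoint_doubling\<close>), which reaches \<open>k = 2\<^sup>l\<close> after \<open>l\<close> steps.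
\<close>

section \<open>Symmetry and positivity of the Laplacian\<close>

abbreviation shifted_laplacian ::
    "('v::finite \<Rightarrow> 'v \<Rightarrow> real) \<Rightarrow> real \<Rightarrow> real ^ 'v \<Rightarrow> real ^ 'v" where
  "shifted_laplacian w \<epsilon> f \<equiv> \<epsilon> *\<^sub>R f + laplacian w f"

text \<open>
  Exchanging the two summation vertices and averaging turns the bilinear form of the Laplacian into
  the Dirichlet form. Symmetry and positivity can both be read off from it.
\<close>

lemma laplacian_dirichlet_form:
  assumes "weighted_graph w"
  shows "2 * (laplacian w f \<bullet> g)
           = (\<Sum>v\<in>UNIV. \<Sum>u\<in>UNIV. w v u * ((f $ v - f $ u) * (g $ v - g $ u)))"
proof -
  have sym: "w u v = w v u" for u v
    using assms by (simp add: weighted_graph_def)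
  have a: "laplacian w f \<bullet> g = (\<Sum>v\<in>UNIV. \<Sum>u\<in>UNIV. w v u * ((f $ v - f $ u) * g $ v))"
    by (simp add: laplacian_def inner_vec_def sum_distrib_left mult_ac)
  also have "\<dots> = (\<Sum>v\<in>UNIV. \<Sum>u\<in>UNIV. w u v * ((f $ u - f $ v) * g $ u))"
    by (rule sum.swap)
  also have "\<dots> = (\<Sum>v\<in>UNIV. \<Sum>u\<in>UNIV. w v u * ((f $ u - f $ v) * g $ u))"
    by (simp add: sym)
  finally have b: "laplacian w f \<bullet> g = \<dots>" .
  have "2 * (laplacian w f \<bullet> g) = laplacian w f \<bullet> g + laplacian w f \<bullet> g"
    by simp
  also have "\<dots> = (\<Sum>v\<in>UNIV. \<Sum>u\<in>UNIV. w v u * ((f $ v - f $ u) * g $ v))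
                + (\<Sum>v\<in>UNIV. \<Sum>u\<in>UNIV. w v u * ((f $ u - f $ v) * g $ u))"
    using a b by simp
  also have "\<dots> = (\<Sum>v\<in>UNIV. \<Sum>u\<in>UNIV. w v u * ((f $ v - f $ u) * (g $ v - g $ u)))"
    unfolding sum.distrib[symmetric]
    by (intro sum.cong refl) (simp add: algebra_simps)
  finally show ?thesis .
qed

lemma laplacian_self_adjoint:
  assumes "weighted_graph w"
  shows "laplacian w f \<bullet> g = f \<bullet> laplacian w g"
proof -
  have "2 * (laplacian w f \<bullet> g) = 2 * (laplacian w g \<bullet> f)"
    unfolding laplacian_dirichlet_form[OF assms] by (simp add: mult_ac)
  then show ?thesis
    by (simp add: inner_commute)
qed

lemma laplacian_positive_semidefinite:
  assumes "weighted_graph w"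
  shows "0 \<le> laplacian w f \<bullet> f"
proof -
  have "0 \<le> 2 * (laplacian w f \<bullet> f)"
    unfolding laplacian_dirichlet_form[OF assms]
    using assms by (intro sum_nonneg) (simp add: weighted_graph_def)
  then show ?thesis
    by simp
qed

lemma linear_laplacian: "linear (laplacian w)"
proof (rule linearI)
  show "laplacian w (f + g) = laplacian w f + laplacian w g" for f g
    unfolding laplacian_def vec_eq_iff
    by (simp add: sum.distrib[symmetric]) (intro allI sum.cong refl, simp add: algebra_simps)
  show "laplacian w (c *\<^sub>R f) = c *\<^sub>R laplacian w f" for c f
    unfolding laplacian_def vec_eq_iff
    by (simp add: sum_distrib_left) (intro allI sum.cong refl, simp add: algebra_simps)
qed

lemma linear_funpow:
  fixes T :: "'a::real_vector \<Rightarrow> 'a"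
  assumes "linear T"
  shows "linear (T ^^ n)"
proof (induction n)
  case 0
  then show ?case
    by (simp add: linear_id[unfolded id_def] id_def)
next
  case (Suc n)
  then show ?case
    using assms by (simp only: funpow.simps linear_compose)
qed

lemma self_adjoint_funpow:
  fixes T :: "'a::real_inner \<Rightarrow> 'a"
  assumes "\<And>f g. T f \<bullet> g = f \<bullet> T g"
  shows "(T ^^ n) f \<bullet> g = f \<bullet> (T ^^ n) g"
proof (induction n arbitrary: f g)
  case (Suc n)
  have "(T ^^ Suc n) f \<bullet> g = f \<bullet> (T ^^ n) (T g)"
    by (simp add: assms Suc)
  then show ?case
    by (simp add: funpow_swap1)
qed simp

lemma linear_shifted_laplacian_power: "linear (shifted_laplacian_power w \<epsilon> k)"
  unfolding shifted_laplacian_power_def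
  by (intro linear_funpow linear_compose_add linear_laplacian linear_scaleR)

lemma shifted_laplacian_self_adjoint:
  assumes "weighted_graph w"
  shows "shifted_laplacian w \<epsilon> f \<bullet> g = f \<bullet> shifted_laplacian w \<epsilon> g"
  using laplacian_self_adjoint[OF assms, of f g] by (simp add: inner_add_left inner_add_right)

text \<open>
  The cross term in the square of the norm of \<open>\<epsilon> f + L f\<close> is nonnegative, since \<open>L\<close> is positive
  semidefinite, and the square of \<open>norm (\<epsilon> f)\<close> is kept because it makes the
  shifted operator injective.
\<close>

lemma norm_shifted_laplacian:
  assumes "weighted_graph w" and "\<epsilon> > 0"
  shows "(\<epsilon> * norm f)\<^sup>2 + (norm (laplacian w f))\<^sup>2 \<le> (norm (shifted_laplacian w \<epsilon> f))\<^sup>2"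
proof -
  have "0 \<le> \<epsilon> * (laplacian w f \<bullet> f)"
    using laplacian_positive_semidefinite[OF assms(1)] assms(2) by simp
  then show ?thesis
    by (simp add: power2_norm_eq_inner inner_add_left inner_add_right inner_commute
        power_mult_distrib power2_eq_square[of \<epsilon>])
qed

lemma norm_laplacian_le_shifted:
  assumes "weighted_graph w" and "\<epsilon> > 0"
  shows "norm (laplacian w f) \<le> norm (shifted_laplacian w \<epsilon> f)"
proof (rule power2_le_imp_le)
  show "(norm (laplacian w f))\<^sup>2 \<le> (norm (shifted_laplacian w \<epsilon> f))\<^sup>2"
    using norm_shifted_laplacian[OF assms, of f] zero_le_power2[of "\<epsilon> * norm f"] by linarith
qed simp

lemma shifted_laplacian_eq_0:
  assumes "weighted_graph w" and "\<epsilon> > 0" and "shifted_laplacian w \<epsilon> f = 0"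
  shows "f = 0"
proof -
  have "(\<epsilon> * norm f)\<^sup>2 + (norm (laplacian w f))\<^sup>2 \<le> 0"
    using norm_shifted_laplacian[OF assms(1,2), of f] assms(3) by simp
  then have "\<epsilon> * norm f = 0"
    by (simp only: sum_power2_le_zero_iff)
  then show ?thesis
    using assms(2) by simp
qed

lemma shifted_laplacian_power_eq_0:
  assumes "weighted_graph w" and "\<epsilon> > 0" and "shifted_laplacian_power w \<epsilon> k f = 0"
  shows "f = 0"
  using assms(3) unfolding shifted_laplacian_power_def
  by (induction k) (auto dest: shifted_laplacian_eq_0[OF assms(1,2)])

section \<open>Poincare inequalities for powers of the operator\<close>

text \<open>
  Self-adjointness and Cauchy--Schwarz give
  \<open>norm (B \<phi>) ^ 2 = \<phi> \<bullet> B (B \<phi>) \<le> norm \<phi> * norm (B (B \<phi>))\<close>; squaring the hypothesis and cancelling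
  \<open>norm \<phi>\<close> yields the bound. Only the one vector \<open>\<phi>\<close> has to satisfy the hypothesis.
\<close>

lemma self_adjoint_doubling:
  fixes B :: "'a::real_inner \<Rightarrow> 'a"
  assumes sa: "\<And>f g. B f \<bullet> g = f \<bullet> B g"
    and le: "norm \<phi> \<le> c * norm (B \<phi>)"
  shows "norm \<phi> \<le> c\<^sup>2 * norm (B (B \<phi>))"
proof (cases "\<phi> = 0")
  case False
  have "norm \<phi> * norm \<phi> \<le> (c * norm (B \<phi>))\<^sup>2"
    using power_mono[OF le, of 2] by (simp add: power2_eq_square)
  also have "\<dots> = c\<^sup>2 * (\<phi> \<bullet> B (B \<phi>))"
    by (simp add: power_mult_distrib power2_norm_eq_inner sa)
  also have "\<dots> \<le> c\<^sup>2 * (norm \<phi> * norm (B (B \<phi>)))"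
    by (intro mult_left_mono norm_cauchy_schwarz) simp
  finally have "norm \<phi> * norm \<phi> \<le> norm \<phi> * (c\<^sup>2 * norm (B (B \<phi>)))"
    by (simp add: mult_ac)
  then show ?thesis
    using False by simp
qed simp

lemma Lambda_set_power_bound:
  assumes w: "weighted_graph w" and \<Lambda>: "Lambda_set w \<Lambda> S" and \<epsilon>: "\<epsilon> > 0"
    and \<phi>: "\<phi> \<in> L2_on S"
  shows "norm \<phi> \<le> \<Lambda> ^ (2 ^ l) * norm (shifted_laplacian_power w \<epsilon> (2 ^ l) \<phi>)"
proof (induction l)
  case 0
  have "norm \<phi> \<le> \<Lambda> * norm (laplacian w \<phi>)"
    using \<Lambda> \<phi> by (simp add: Lambda_set_def)
  also have "\<dots> \<le> \<Lambda> * norm (shifted_laplacian w \<epsilon> \<phi>)"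
    using \<Lambda> by (intro mult_left_mono norm_laplacian_le_shifted w \<epsilon>) (simp add: Lambda_set_def)
  finally show ?case
    by (simp add: shifted_laplacian_power_def)
next
  case (Suc l)
  have "norm \<phi> \<le> (\<Lambda> ^ (2 ^ l))\<^sup>2
      * norm (shifted_laplacian_power w \<epsilon> (2 ^ l) (shifted_laplacian_power w \<epsilon> (2 ^ l) \<phi>))"
    by (rule self_adjoint_doubling[where B = "shifted_laplacian_power w \<epsilon> (2 ^ l)", OF _ Suc])
      (simp add: shifted_laplacian_power_def self_adjoint_funpow shifted_laplacian_self_adjoint[OF w])
  then show ?case
    by (simp add: shifted_laplacian_power_def mult_2 funpow_add power_add power2_eq_square)
qed

section \<open>Variational splines as orthogonal projections\<close>

lemma pythagoras_norm:
  fixes a b :: "'a::real_inner"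
  assumes "a \<bullet> b = 0"
  shows "(norm (a + b))\<^sup>2 = (norm a)\<^sup>2 + (norm b)\<^sup>2"
  using assms by (simp add: power2_norm_eq_inner inner_add_left inner_add_right inner_commute)

lemma subspace_L2_on: "subspace (L2_on S)"
  by (simp add: subspace_def L2_on_def)

text \<open>
  To obtain the minimiser, take any interpolant and subtract the element of \<open>L2_on (- U)\<close> whose image
  under \<open>A = (\<epsilon> I + L)\<^sup>k\<close> is the orthogonal projection of the image of the interpolant. It is the only one because, by Pythagoras, passing to another interpolant adds the
  squared norm of the image of the difference, which is positive by injectivity.
\<close>

lemma variational_spline_orthogonal:
  fixes w :: "'v::finite \<Rightarrow> 'v \<Rightarrow> real" and U :: "'v set" and y :: "'v \<Rightarrow> real"
    and \<epsilon> :: real and k :: nat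
  assumes w: "weighted_graph w" and \<epsilon>: "\<epsilon> > 0"
  defines "Y \<equiv> variational_spline w U k \<epsilon> y"
  shows "\<forall>u\<in>U. Y $ u = y u"
    and "\<forall>\<psi>\<in>L2_on (- U). shifted_laplacian_power w \<epsilon> k Y \<bullet> shifted_laplacian_power w \<epsilon> k \<psi> = 0"
proof -
  let ?A = "shifted_laplacian_power w \<epsilon> k"
  have lin: "linear ?A"
    by (rule linear_shifted_laplacian_power)
  obtain p q where p: "p \<in> span (?A ` L2_on (- U))"
    and q: "\<And>x. x \<in> span (?A ` L2_on (- U)) \<Longrightarrow> orthogonal q x"
    and pq: "?A (\<chi> v. y v) = p + q"
    using orthogonal_subspace_decomp_exists by metis
  have "span (?A ` L2_on (- U)) = ?A ` L2_on (- U)"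
    by (intro span_eq_iff[THEN iffD2] linear_subspace_image lin subspace_L2_on)
  then obtain \<phi> where \<phi>: "\<phi> \<in> L2_on (- U)" "p = ?A \<phi>"
    using p by blast
  define X where "X = (\<chi> v. y v) - \<phi>"
  have X_U: "\<forall>u\<in>U. X $ u = y u"
    using \<phi>(1) by (simp add: X_def L2_on_def)
  have "?A X = q"
    using pq \<phi>(2) by (simp add: X_def linear_diff[OF lin])
  then have X_orth: "\<forall>\<psi>\<in>L2_on (- U). ?A X \<bullet> ?A \<psi> = 0"
    using q by (simp add: orthogonal_def span_base)
  have pyth: "(norm (?A Z))\<^sup>2 = (norm (?A X))\<^sup>2 + (norm (?A (Z - X)))\<^sup>2"
    if "\<forall>u\<in>U. Z $ u = y u" for Z
  proof -
    have "Z - X \<in> L2_on (- U)"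
      using that X_U by (simp add: L2_on_def)
    then have "(norm (?A X + ?A (Z - X)))\<^sup>2 = (norm (?A X))\<^sup>2 + (norm (?A (Z - X)))\<^sup>2"
      using X_orth by (intro pythagoras_norm) simp
    then show ?thesis
      by (simp add: linear_diff[OF lin])
  qed
  have "Y = X"
    unfolding Y_def variational_spline_def
  proof (rule the_equality)
    have "norm (?A X) \<le> norm (?A Z)" if "\<forall>u\<in>U. Z $ u = y u" for Z
      using pyth[OF that] by (intro power2_le_imp_le[of "norm (?A X)"]) simp_all
    then show "is_variational_spline w U k \<epsilon> y X"
      using X_U by (simp add: is_variational_spline_def)
  next
    fix Z
    assume Z: "is_variational_spline w U k \<epsilon> y Z"
    then have Z_U: "\<forall>u\<in>U. Z $ u = y u" and "norm (?A Z) \<le> norm (?A X)"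
      using X_U by (auto simp: is_variational_spline_def)
    then have "(norm (?A Z))\<^sup>2 \<le> (norm (?A X))\<^sup>2"
      by (intro power_mono) simp_all
    then have "?A (Z - X) = 0"
      using pyth[OF Z_U] by simp
    then have "Z - X = 0"
      by (rule shifted_laplacian_power_eq_0[OF w \<epsilon>])
    then show "Z = X"
      by simp
  qed
  then show "\<forall>u\<in>U. Y $ u = y u" "\<forall>\<psi>\<in>L2_on (- U). ?A Y \<bullet> ?A \<psi> = 0"
    using X_U X_orth by simp_all
qed

section \<open>The quadrature error\<close>

lemma sum_L2_on_le:
  assumes "\<phi> \<in> L2_on S"
  shows "\<bar>\<Sum>v\<in>UNIV. \<phi> $ v\<bar> \<le> sqrt (real (card S)) * norm \<phi>"
proof -
  define e :: "real ^ 'a" where "e = (\<chi> v. if v \<in> S then 1 else 0)"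
  have "e \<bullet> \<phi> = (\<Sum>v\<in>UNIV. \<phi> $ v)"
    unfolding inner_vec_def
    using assms by (intro sum.cong) (auto simp: e_def L2_on_def)
  moreover have "norm e = sqrt (real (card S))"
    by (simp add: norm_eq_sqrt_inner inner_vec_def e_def if_distrib[of "\<lambda>x. x * x"] sum.If_cases)
  ultimately show ?thesis
    using Cauchy_Schwarz_ineq2[of e \<phi>] by simp
qed

theorem theorem3p3:
  fixes w :: "'v::finite \<Rightarrow> 'v \<Rightarrow> real"
    and U S :: "'v set"
    and \<Lambda> \<epsilon> :: real
    and k l :: nat
  assumes "weighted_graph w"
    and "S = UNIV - U"
    and "Lambda_set w \<Lambda> S"
    and "\<epsilon> > 0"
    and "k = 2 ^ l"
  shows "\<exists>\<theta> :: 'v \<Rightarrow> real.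
           (\<forall>u\<in>U. \<theta> u = (\<Sum>v\<in>UNIV. lagrangian_spline w U k \<epsilon> u $ v)) \<and>
           (\<forall>f :: real ^ 'v.
              \<bar>(\<Sum>v\<in>UNIV. f $ v) - (\<Sum>u\<in>U. f $ u * \<theta> u)\<bar>
                \<le> 2 * sqrt (real (card S)) * \<Lambda> ^ k * norm (shifted_laplacian_power w \<epsilon> k f))"
proof -
  let ?A = "shifted_laplacian_power w \<epsilon> k"
  define L where "L = lagrangian_spline w U k \<epsilon>"
  define \<theta> where "\<theta> u = (\<Sum>v\<in>UNIV. L u $ v)" for u
  have lin: "linear ?A"
    by (rule linear_shifted_laplacian_power)
  have S: "S = - U"
    using assms(2) by auto
  have L_U: "L u $ v = (if v = u then 1 else 0)" if "v \<in> U" for u v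
    using variational_spline_orthogonal(1)[OF assms(1,4)] that
    by (simp add: L_def lagrangian_spline_def)
  have L_orth: "?A (L u) \<bullet> ?A \<psi> = 0" if "\<psi> \<in> L2_on S" for u \<psi>
    using variational_spline_orthogonal(2)[OF assms(1,4)] that
    by (simp add: L_def lagrangian_spline_def S)
  have "\<bar>(\<Sum>v\<in>UNIV. f $ v) - (\<Sum>u\<in>U. f $ u * \<theta> u)\<bar>
      \<le> 2 * sqrt (real (card S)) * \<Lambda> ^ k * norm (?A f)" for f
  proof -
    define I where "I = (\<Sum>u\<in>U. f $ u *\<^sub>R L u)"
    have "I $ v = f $ v" if "v \<in> U" for v
      using that by (simp add: I_def L_U if_distrib[of "\<lambda>x. _ * x"] cong: if_cong)
    then have \<phi>: "f - I \<in> L2_on S"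
      by (simp add: L2_on_def S)
    have "?A I \<bullet> ?A (f - I) = (\<Sum>u\<in>U. f $ u * (?A (L u) \<bullet> ?A (f - I)))"
      by (simp add: I_def linear_sum[OF lin] linear_scale[OF lin] inner_sum_left)
    also have "\<dots> = 0"
      by (simp add: L_orth[OF \<phi>])
    finally have "(norm (?A I + ?A (f - I)))\<^sup>2 = (norm (?A I))\<^sup>2 + (norm (?A (f - I)))\<^sup>2"
      by (rule pythagoras_norm)
    then have "(norm (?A (f - I)))\<^sup>2 \<le> (norm (?A f))\<^sup>2"
      by (simp add: linear_diff[OF lin])
    then have le_f: "norm (?A (f - I)) \<le> norm (?A f)"
      by (rule power2_le_imp_le) simp
    have \<Lambda>: "0 \<le> \<Lambda> ^ k"
      using assms(3) by (simp add: Lambda_set_def)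
    have "norm (f - I) \<le> \<Lambda> ^ k * norm (?A (f - I))"
      using Lambda_set_power_bound[OF assms(1,3,4) \<phi>] assms(5) by simp
    also have "\<dots> \<le> \<Lambda> ^ k * norm (?A f)"
      using le_f \<Lambda> by (rule mult_left_mono)
    finally have norm_\<phi>: "norm (f - I) \<le> \<Lambda> ^ k * norm (?A f)" .
    have "(\<Sum>v\<in>UNIV. I $ v) = (\<Sum>u\<in>U. f $ u * \<theta> u)"
      unfolding I_def \<theta>_def by (simp add: sum_distrib_left) (rule sum.swap)
    then have "\<bar>(\<Sum>v\<in>UNIV. f $ v) - (\<Sum>u\<in>U. f $ u * \<theta> u)\<bar> = \<bar>\<Sum>v\<in>UNIV. (f - I) $ v\<bar>"
      by (simp add: sum_subtractf)
    also have "\<dots> \<le> sqrt (real (card S)) * norm (f - I)"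
      by (rule sum_L2_on_le[OF \<phi>])
    also have "\<dots> \<le> sqrt (real (card S)) * (\<Lambda> ^ k * norm (?A f))"
      using norm_\<phi> by (intro mult_left_mono) simp_all
    also have "\<dots> \<le> 2 * (sqrt (real (card S)) * (\<Lambda> ^ k * norm (?A f)))"
      using \<Lambda> by simp
    finally show ?thesis
      by (simp add: mult_ac)
  qed
  then show ?thesis
    by (intro exI[of _ \<theta>]) (simp add: \<theta>_def L_def)
qed

end
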